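(* Let $\theta>0$, $n\ge1$, and let $M_n$ be the maximum of a sample $X_1,\dots,X_n$ of size $n$ from $\mathsf{GEM}(0,\theta)$. Then $$M_n:=\max_{1\le i\le n}X_i=\max\{b:N^\circ_{b:n}>0\}=1+\sum_{i=1}^n G_{i:n}\overset{d}{=}1+\sum_{i=1}^n G_i,$$ where the $G_i$ are independent and $G_i$ has the geometric$(i/(i+\theta))$ distribution.
   Context: The $\mathsf{GEM}(0,\theta)$ distribution is the law of the random probability distribution $P_\bullet=(P_1,P_2,\dots)$ on $\{1,2,\dots\}$ given by $P_j:=H_j\prod_{i=1}^{j-1}(1-H_i)$ with $H_1,H_2,\dots$ i.i.d. beta$(1,\theta)$. A sample from $P_\bullet$ means that, conditionally given $P_\bullet$, $X_1,\dots,X_n$ are i.i.d. with $\mathbb{P}(X_i=b\mid P_\bullet)=P_b$. The counts are $N^\circ_{b:n}:=\sum_{i=1}^n\mathbf{1}(X_i=b)$, $b=1,2,\dots$. With order statistics $X_{1:n}\le\cdots\le X_{n:n}$, the gaps are $G_{i:n}:=X_{n+1-i:n}-X_{n-i:n}$ for $1\le i\le n-1$ and $G_{n:n}:=X_{1:n}-1$. The geometric$(p)$ distribution is on $\{0,1,2,\dots\}$: $\mathbb{P}(G=k)=p(1-p)^k$. The symbol $\overset{d}{=}$ denotes equality in distribution. *)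

theory Defs
  imports "HOL-Probability.Probability"
begin

definition beta_density :: "real \<Rightarrow> real \<Rightarrow> real \<Rightarrow> real" where
  "beta_density a b x =
     (if 0 < x \<and> x < 1 then x powr (a - 1) * (1 - x) powr (b - 1) / Beta a b else 0)"

definition beta_measure :: "real \<Rightarrow> real \<Rightarrow> real measure" where
  "beta_measure a b = density lborel (\<lambda>x. ennreal (beta_density a b x))"

text \<open>Sequences indexed by $\{1,2,\ldots\}$ are elements of products over \<open>{1..}\<close>,
  hence the restrictions \<open>\<lambda>j\<in>{1..}\<close>.\<close>

definition stick_breaking :: "(nat \<Rightarrow> real) \<Rightarrow> nat \<Rightarrow> real" where
  "stick_breaking h = (\<lambda>j\<in>{1..}. h j * (\<Prod>i\<in>{1..<j}. 1 - h i))"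

definition GEM :: "real \<Rightarrow> (nat \<Rightarrow> real) measure" where
  "GEM \<theta> = distr (\<Pi>\<^sub>M j\<in>{1..}. beta_measure 1 \<theta>) (\<Pi>\<^sub>M j\<in>{1..}. borel) stick_breaking"

definition generated_algebra :: "'a measure \<Rightarrow> (nat \<Rightarrow> 'a \<Rightarrow> real) \<Rightarrow> 'a measure" where
  "generated_algebra M P =
     vimage_algebra (space M) (\<lambda>\<omega>. \<lambda>j\<in>{1..}. P j \<omega>) (\<Pi>\<^sub>M j\<in>{1..}. borel)"

definition conditional_prob :: "'a measure \<Rightarrow> 'a measure \<Rightarrow> 'a set \<Rightarrow> 'a \<Rightarrow> real" where
  "conditional_prob M F A = real_cond_exp M F (indicator A)"

text \<open>The sets \<open>B i\<close> are arbitrary because the variables are discrete; since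
  \<open>B i = UNIV\<close> is allowed, factorization over subfamilies of \<open>I\<close> is included.\<close>

definition cond_indep_nat_vars ::
    "'a measure \<Rightarrow> 'a measure \<Rightarrow> (nat \<Rightarrow> 'a \<Rightarrow> nat) \<Rightarrow> nat set \<Rightarrow> bool" where
  "cond_indep_nat_vars M F X I \<longleftrightarrow>
     (\<forall>B :: nat \<Rightarrow> nat set. AE \<omega> in M.
        conditional_prob M F {\<omega>'\<in>space M. \<forall>i\<in>I. X i \<omega>' \<in> B i} \<omega> =
        (\<Prod>i\<in>I. conditional_prob M F {\<omega>'\<in>space M. X i \<omega>' \<in> B i} \<omega>))"

text \<open>\<open>X 1, \<dots>, X n\<close> is a sample from the random distribution \<open>P 1, P 2, \<dots>\<close>, where only the
  law of \<open>P\<close> is prescribed: the underlying space need not carry the beta variables.\<close>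

definition GEM_sample ::
    "'a measure \<Rightarrow> real \<Rightarrow> (nat \<Rightarrow> 'a \<Rightarrow> real) \<Rightarrow> nat \<Rightarrow> (nat \<Rightarrow> 'a \<Rightarrow> nat) \<Rightarrow> bool" where
  "GEM_sample M \<theta> P n X \<longleftrightarrow>
     (\<forall>j\<ge>1. P j \<in> borel_measurable M) \<and>
     distr M (\<Pi>\<^sub>M j\<in>{1..}. borel) (\<lambda>\<omega>. \<lambda>j\<in>{1..}. P j \<omega>) = GEM \<theta> \<and>
     (\<forall>i\<in>{1..n}. X i \<in> measurable M (count_space {1..})) \<and>
     cond_indep_nat_vars M (generated_algebra M P) X {1..n} \<and>
     (\<forall>i\<in>{1..n}. \<forall>b\<ge>1. AE \<omega> in M.
        conditional_prob M (generated_algebra M P) {\<omega>'\<in>space M. X i \<omega>' = b} \<omega> = P b \<omega>)"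

definition sample_count :: "(nat \<Rightarrow> 'a \<Rightarrow> nat) \<Rightarrow> nat \<Rightarrow> nat \<Rightarrow> 'a \<Rightarrow> nat" where
  "sample_count X n b \<omega> = (\<Sum>i=1..n. of_bool (X i \<omega> = b))"

definition order_stat :: "(nat \<Rightarrow> 'a \<Rightarrow> nat) \<Rightarrow> nat \<Rightarrow> nat \<Rightarrow> 'a \<Rightarrow> nat" where
  "order_stat X n k \<omega> = sort (map (\<lambda>i. X i \<omega>) [1..<n+1]) ! (k - 1)"

text \<open>The natural-number subtractions do not truncate: order statistics are nondecreasing
  in \<open>k\<close>, and sample values are at least 1.\<close>

definition sample_gap :: "(nat \<Rightarrow> 'a \<Rightarrow> nat) \<Rightarrow> nat \<Rightarrow> nat \<Rightarrow> 'a \<Rightarrow> nat" where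
  "sample_gap X n i \<omega> =
     (if i = n then order_stat X n 1 \<omega> - 1
      else order_stat X n (n + 1 - i) \<omega> - order_stat X n (n - i) \<omega>)"

definition sample_max :: "(nat \<Rightarrow> 'a \<Rightarrow> nat) \<Rightarrow> nat \<Rightarrow> 'a \<Rightarrow> nat" where
  "sample_max X n \<omega> = Max ((\<lambda>i. X i \<omega>) ` {1..n})"

end

theory Submission
  imports Defs
begin

text \<open>The pathwise identities are combinatorics: the boxes with positive count are exactly the
  sampled values, and the gaps telescope from the largest order statistic down to \<open>1\<close>.

  For the equality in law, the distribution functions of both sides are compared. Let \<open>T\<^sub>b\<close> be the
  stick that remains after \<open>b\<close> breaks, the product of \<open>1 - H\<^sub>i\<close> over \<open>i \<le> b\<close>. The first \<open>b\<close> boxes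
  carry mass \<open>1 - T\<^sub>b\<close>, so given the frequencies all \<open>n\<close> sample points lie in these boxes with
  probability \<open>(1 - T\<^sub>b)\<^sup>n\<close>. Since \<open>1 - H\<^sub>i\<close> has \<open>k\<close>-th moment \<open>\<theta> / (\<theta> + k)\<close>, independence and the
  binomial theorem give
  \[ P(M_n \le b) = \sum_{k \le n} {n \choose k} (-1)^k (\theta/(\theta+k))^b. \]
  Call the right-hand side \<open>F n b\<close>. The weights \<open>\<theta> / (\<theta> + k)\<close> are such that the absorption identity
  for binomial coefficients turns into the recurrence
  \[ (\theta + n)\, F\,n\,b = n\, F\,(n-1)\,b + \theta\, F\,n\,(b-1) \]
  (\<open>gem_max_cdf_Suc\<close>).

  On the other side, \<open>G\<^sub>n\<close> is \<open>0\<close> with probability \<open>n / (n + \<theta>)\<close>; otherwise \<open>G\<^sub>n - 1\<close> has again the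
  same geometric law. Hence \<open>P(G\<^sub>1 + \<dots> + G\<^sub>n < b)\<close>
  satisfies the same recurrence (\<open>prob_sum_geometric_step\<close>), with the same boundary values, and
  the two distribution functions agree.\<close>

section \<open>Order statistics and gaps\<close>

lemma sample_max_eq_Max_counted:
  assumes "\<And>i. i \<in> {1..n} \<Longrightarrow> X i \<omega> \<ge> 1"
  shows "sample_max X n \<omega> = Max {b. b \<ge> 1 \<and> sample_count X n b \<omega> > 0}"
proof -
  have "sample_count X n b \<omega> > 0 \<longleftrightarrow> b \<in> (\<lambda>i. X i \<omega>) ` {1..n}" for b
    by (auto simp: sample_count_def sum_nonneg_eq_0_iff simp flip: neq0_conv)
  hence "{b. b \<ge> 1 \<and> sample_count X n b \<omega> > 0} = (\<lambda>i. X i \<omega>) ` {1..n}"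
    using assms by auto
  thus ?thesis by (simp add: sample_max_def)
qed

lemma order_stat_mono:
  assumes "1 \<le> j" "j \<le> k" "k \<le> n"
  shows "order_stat X n j \<omega> \<le> order_stat X n k \<omega>"
  using assms unfolding order_stat_def by (intro sorted_nth_mono) auto

lemma order_stat_mem:
  assumes "1 \<le> k" "k \<le> n"
  shows "order_stat X n k \<omega> \<in> (\<lambda>i. X i \<omega>) ` {1..n}"
proof -
  let ?xs = "map (\<lambda>i. X i \<omega>) [1..<n+1]"
  have "sort ?xs ! (k - 1) \<in> set (sort ?xs)"
    using assms by (intro nth_mem) auto
  also have "set (sort ?xs) = (\<lambda>i. X i \<omega>) ` {1..n}"
    by (simp add: atLeastLessThanSuc_atLeastAtMost del: upt_Suc)
  finally show ?thesis by (simp add: order_stat_def)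
qed

lemma order_stat_last_eq_sample_max:
  assumes "n \<ge> 1"
  shows "order_stat X n n \<omega> = sample_max X n \<omega>"
  unfolding sample_max_def
proof (rule Max_eqI[symmetric])
  show "order_stat X n n \<omega> \<in> (\<lambda>i. X i \<omega>) ` {1..n}"
    using assms by (intro order_stat_mem) auto
next
  let ?xs = "map (\<lambda>i. X i \<omega>) [1..<n+1]"
  fix x assume "x \<in> (\<lambda>i. X i \<omega>) ` {1..n}"
  hence "x \<in> set (sort ?xs)"
    by (simp add: atLeastLessThanSuc_atLeastAtMost del: upt_Suc)
  then obtain j where "j < n" and x: "x = sort ?xs ! j"
    by (simp only: in_set_conv_nth length_sort length_map length_upt) auto
  thus "x \<le> order_stat X n n \<omega>"
    using order_stat_mono[of "Suc j" n n X \<omega>] by (simp add: order_stat_def del: upt_Suc)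
qed simp

text \<open>The \<open>m\<close> topmost gaps bridge the distance between the maximum and the order statistic \<open>m\<close> places
  below it. Adding them to the lower order statistic avoids truncated subtraction.\<close>
lemma sum_sample_gap_above:
  assumes "m < n"
  shows "order_stat X n (n - m) \<omega> + (\<Sum>i=1..m. sample_gap X n i \<omega>) = order_stat X n n \<omega>"
  using assms
proof (induction m)
  case (Suc m)
  have "order_stat X n (n - Suc m) \<omega> \<le> order_stat X n (n - m) \<omega>"
    using Suc.prems by (intro order_stat_mono) auto
  thus ?case
    using Suc by (simp add: sample_gap_def)
qed simp

lemma sample_max_eq_sum_gaps:
  assumes "n \<ge> 1" and "\<And>i. i \<in> {1..n} \<Longrightarrow> X i \<omega> \<ge> 1"
  shows "sample_max X n \<omega> = 1 + (\<Sum>i=1..n. sample_gap X n i \<omega>)"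
proof -
  have "order_stat X n 1 \<omega> \<ge> 1"
    using order_stat_mem[of 1 n X \<omega>] assms by auto
  moreover have "(\<Sum>i=1..n. sample_gap X n i \<omega>) =
      sample_gap X n n \<omega> + (\<Sum>i=1..n-1. sample_gap X n i \<omega>)"
    using assms(1) by (cases n) auto
  ultimately show ?thesis
    using sum_sample_gap_above[of "n - 1" n X \<omega>] order_stat_last_eq_sample_max[of n X \<omega>] assms(1)
    by (simp add: sample_gap_def)
qed

section \<open>The distribution function of the maximum in closed form\<close>

text \<open>The alternating sum is the expectation of \<open>(1 - T\<^sub>b)\<^sup>n\<close>, with \<open>T\<^sub>b\<close> the stick remaining after
  \<open>b\<close> breaks, expanded by the binomial theorem.\<close>
definition gem_max_cdf :: "real \<Rightarrow> nat \<Rightarrow> nat \<Rightarrow> real" where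
  "gem_max_cdf \<theta> n b = (\<Sum>k\<le>n. of_nat (n choose k) * (-1) ^ k * (\<theta> / (\<theta> + k)) ^ b)"

lemma gem_max_cdf_0_left:
  assumes "\<theta> > 0"
  shows "gem_max_cdf \<theta> 0 b = 1"
  using assms by (simp add: gem_max_cdf_def)

lemma gem_max_cdf_0_right:
  assumes "n \<ge> 1"
  shows "gem_max_cdf \<theta> n 0 = 0"
  using assms choose_alternating_sum[of n, where 'a=real] by (simp add: gem_max_cdf_def mult.commute)

text \<open>Multiplying the \<open>k\<close>-th term by \<open>\<theta> + k\<close> removes one of its factors \<open>\<theta> / (\<theta> + k)\<close> and so lowers \<open>b\<close>
  by one, up to a factor \<open>\<theta>\<close>. The difference of the two sums over \<open>n + 1\<close> and over \<open>n\<close> has exactly this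
  weight, by absorption, \<open>k (n+1 choose k) = (n+1) (n choose k-1)\<close>, and Pascal's rule.\<close>
lemma gem_max_cdf_Suc:
  fixes \<theta> :: real
  assumes "\<theta> > 0"
  shows "(\<theta> + Suc n) * gem_max_cdf \<theta> (Suc n) (Suc b) =
         Suc n * gem_max_cdf \<theta> n (Suc b) + \<theta> * gem_max_cdf \<theta> (Suc n) b"
proof -
  let ?m = "\<lambda>k. \<theta> / (\<theta> + real k)"
  \<comment> \<open>The extra term \<open>k = n + 1\<close> vanishes, so both sums have the same range.\<close>
  have ext: "gem_max_cdf \<theta> n (Suc b) =
      (\<Sum>k\<le>Suc n. of_nat (n choose k) * (-1) ^ k * ?m k ^ Suc b)"
    by (simp add: gem_max_cdf_def)
  have binom: "Suc n * (Suc n choose k) = Suc n * (n choose k) + k * (Suc n choose k)" for k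
  proof (cases k)
    case (Suc j)
    have "k * (Suc n choose k) = Suc n * (n choose j)"
      unfolding Suc by (rule Suc_times_binomial)
    moreover have "Suc n choose k = (n choose j) + (n choose k)"
      unfolding Suc by simp
    ultimately show ?thesis by (simp only: add_mult_distrib2 add.commute)
  qed simp
  have weight: "(\<theta> + real (Suc n)) * real (Suc n choose k) - real (Suc n) * real (n choose k) =
      (\<theta> + real k) * real (Suc n choose k)" for k
    using arg_cong[OF binom[of k], of real]
    by (simp only: of_nat_mult of_nat_add distrib_right)
  have cancel: "(\<theta> + real k) * ?m k ^ Suc b = \<theta> * ?m k ^ b" for k
    using assms by simp
  have "(\<theta> + real (Suc n)) * gem_max_cdf \<theta> (Suc n) (Suc b) - real (Suc n) * gem_max_cdf \<theta> n (Suc b) =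
        (\<Sum>k\<le>Suc n. ((\<theta> + real (Suc n)) * real (Suc n choose k) - real (Suc n) * real (n choose k)) *
            ((-1) ^ k * ?m k ^ Suc b))"
    unfolding ext unfolding gem_max_cdf_def
    by (simp only: sum_distrib_left sum_subtractf left_diff_distrib mult.assoc)
  also have "\<dots> = (\<Sum>k\<le>Suc n. real (Suc n choose k) * (-1) ^ k * ((\<theta> + real k) * ?m k ^ Suc b))"
    unfolding weight by (simp only: mult_ac)
  also have "\<dots> = \<theta> * gem_max_cdf \<theta> (Suc n) b"
    unfolding cancel by (simp only: gem_max_cdf_def sum_distrib_left mult_ac)
  finally show ?thesis by simp
qed

section \<open>Moments of the remaining stick\<close>

lemma Beta_1_left:
  assumes "b > (0::real)"
  shows "Beta 1 b = 1 / b"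
proof -
  have "b \<notin> \<int>\<^sub>\<le>\<^sub>0" using assms nonpos_Ints_nonpos by force
  hence "Gamma b \<noteq> 0" by (simp add: Gamma_eq_zero_iff)
  moreover have "Gamma (1 + b) = b * Gamma b"
    using \<open>b \<notin> \<int>\<^sub>\<le>\<^sub>0\<close> Gamma_plus1[of b] by (simp add: add.commute)
  ultimately show ?thesis
    using assms by (simp add: Beta_def)
qed

lemma borel_measurable_beta_density [measurable]: "beta_density a b \<in> borel_measurable borel"
  unfolding beta_density_def[abs_def] by measurable

lemma space_beta_measure [simp]: "space (beta_measure a b) = UNIV"
  by (simp add: beta_measure_def)

lemma sets_beta_measure [simp, measurable_cong]: "sets (beta_measure a b) = sets borel"
  by (simp add: beta_measure_def)

lemma AE_beta_measure: "AE x in beta_measure a b. 0 < x \<and> x < 1"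
  unfolding beta_measure_def by (subst AE_density) (auto simp: beta_density_def)

text \<open>The factor \<open>(1 - x)\<^sup>k\<close> only shifts the second beta parameter from \<open>\<theta>\<close> to \<open>\<theta> + k\<close>, so the moment is
  \<open>Beta 1 (\<theta> + k) / Beta 1 \<theta>\<close>. Taking the integral with nonnegative values first means that \<open>k = 0\<close>
  also yields total mass \<open>1\<close>.\<close>
lemma nn_integral_beta_power:
  assumes "\<theta> > 0"
  shows "(\<integral>\<^sup>+x. ennreal ((1 - x) ^ k) \<partial>beta_measure 1 \<theta>) = ennreal (\<theta> / (\<theta> + k))"
proof -
  have "((\<lambda>x. x powr (1 - 1) * (1 - x) powr ((\<theta> + k) - 1)) has_integral Beta 1 (\<theta> + k)) {0..1}"
    using assms by (intro has_integral_Beta_real) auto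
  hence "((\<lambda>x. x powr (1 - 1) * (1 - x) powr ((\<theta> + k) - 1)) has_integral 1 / (\<theta> + k)) {0<..<1}"
    using assms by (simp add: Beta_1_left has_integral_Icc_iff_Ioo)
  hence "((\<lambda>x. \<theta> * (x powr (1 - 1) * (1 - x) powr ((\<theta> + k) - 1))) has_integral \<theta> * (1 / (\<theta> + k))) {0<..<1}"
    by (rule has_integral_mult_right)
  hence "(\<integral>\<^sup>+x. ennreal (\<theta> * (x powr (1 - 1) * (1 - x) powr ((\<theta> + k) - 1))) * indicator {0<..<1} x \<partial>lborel)
      = ennreal (\<theta> * (1 / (\<theta> + k)))"
    using assms by (intro nn_integral_has_integral_lebesgue') auto
  moreover have "ennreal (beta_density 1 \<theta> x) * ennreal ((1 - x) ^ k) =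
      ennreal (\<theta> * (x powr (1 - 1) * (1 - x) powr ((\<theta> + k) - 1))) * indicator {0<..<1} x" for x
    using assms
    by (auto simp: beta_density_def Beta_1_left indicator_def powr_add powr_realpow powr_diff
          ennreal_mult'[symmetric])
  ultimately show ?thesis
    by (simp add: beta_measure_def nn_integral_density)
qed

lemma prob_space_beta_measure:
  assumes "\<theta> > 0" shows "prob_space (beta_measure 1 \<theta>)"
  using nn_integral_beta_power[OF assms, of 0] assms by (intro prob_spaceI) simp

lemma has_bochner_integral_beta_power:
  assumes "\<theta> > 0"
  shows "has_bochner_integral (beta_measure 1 \<theta>) (\<lambda>x. (1 - x) ^ k) (\<theta> / (\<theta> + k))"
proof (intro has_bochner_integral_nn_integral nn_integral_beta_power)
  show "AE x in beta_measure 1 \<theta>. 0 \<le> (1 - x) ^ k"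
    using AE_beta_measure[of 1 \<theta>] by eventually_elim simp
qed (use assms in auto)

text \<open>Telescoping: the \<open>j\<close>-th frequency is the amount by which the \<open>j\<close>-th break shortens the remaining stick.\<close>
lemma stick_breaking_sum:
  "(\<Sum>j=1..b. stick_breaking h j) = 1 - (\<Prod>i=1..b. 1 - h i)"
proof (induction b)
  case (Suc b)
  have "{1..<Suc b} = {1..b}" by auto
  with Suc show ?case by (simp add: stick_breaking_def algebra_simps)
qed simp

lemma measurable_stick_breaking [measurable]:
  "stick_breaking \<in> (\<Pi>\<^sub>M j\<in>{1..}. beta_measure a b) \<rightarrow>\<^sub>M (\<Pi>\<^sub>M j\<in>{1..}. borel)"
proof -
  have "(\<lambda>h. h j * (\<Prod>i\<in>{1..<j}. 1 - h i)) \<in> borel_measurable (\<Pi>\<^sub>M j\<in>{1..}. beta_measure a b)"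
    if "j \<in> {1..}" for j
  proof -
    have *: "(\<lambda>h. h i) \<in> borel_measurable (\<Pi>\<^sub>M j\<in>{1..}. beta_measure a b)" if "i \<ge> 1" for i :: nat
      using measurable_component_singleton[of i "{1..}" "\<lambda>_. beta_measure a b"] that
      by (simp cong: measurable_cong_sets)
    show ?thesis using that
      by (intro borel_measurable_times borel_measurable_prod borel_measurable_diff borel_measurable_const *) auto
  qed
  thus ?thesis unfolding stick_breaking_def[abs_def] by (intro measurable_restrict)
qed

text \<open>The integrand depends on the first \<open>b\<close> coordinates only, so the infinite product measure can be
  replaced by a finite one, on which the integral of a product factorises.\<close>
lemma has_bochner_integral_remaining_stick:
  assumes "\<theta> > 0"
  shows "has_bochner_integral (\<Pi>\<^sub>M j\<in>{1..}. beta_measure 1 \<theta>)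
           (\<lambda>h. (\<Prod>i=1..b. 1 - h i) ^ k) ((\<theta> / (\<theta> + k)) ^ b)"
proof -
  let ?B = "beta_measure 1 \<theta>" and ?J = "{1..b}"
  interpret B: prob_space ?B by (rule prob_space_beta_measure) fact
  interpret product_prob_space "\<lambda>_. ?B" "{1::nat..}" by unfold_locales
  have mom: "integrable ?B (\<lambda>x. (1 - x) ^ k)" "(\<integral>x. (1 - x) ^ k \<partial>?B) = \<theta> / (\<theta> + k)"
    using has_bochner_integral_beta_power[OF assms, of k] by (auto simp: has_bochner_integral_iff)
  have "has_bochner_integral (\<Pi>\<^sub>M j\<in>?J. ?B) (\<lambda>h. \<Prod>i=1..b. (1 - h i) ^ k) ((\<theta> / (\<theta> + k)) ^ b)"
    unfolding has_bochner_integral_iff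
    using product_integrable_prod[of ?J "\<lambda>_ x. (1 - x) ^ k"]
          product_integral_prod[of ?J "\<lambda>_ x. (1 - x) ^ k"] mom by simp
  also have "(\<Pi>\<^sub>M j\<in>?J. ?B) = distr (\<Pi>\<^sub>M j\<in>{1..}. ?B) (\<Pi>\<^sub>M j\<in>?J. ?B) (\<lambda>h. restrict h ?J)"
    by (rule distr_PiM_restrict_finite[symmetric]) auto
  finally have D: "has_bochner_integral (distr (\<Pi>\<^sub>M j\<in>{1..}. ?B) (\<Pi>\<^sub>M j\<in>?J. ?B) (\<lambda>h. restrict h ?J))
       (\<lambda>h. \<Prod>i=1..b. (1 - h i) ^ k) ((\<theta> / (\<theta> + k)) ^ b)" .
  have restr: "(\<lambda>h. restrict h ?J) \<in> (\<Pi>\<^sub>M j\<in>{1..}. ?B) \<rightarrow>\<^sub>M (\<Pi>\<^sub>M j\<in>?J. ?B)"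
    by (rule measurable_restrict_subset) auto
  have "(\<lambda>h. \<Prod>i=1..b. (1 - h i) ^ k) \<in> borel_measurable (\<Pi>\<^sub>M j\<in>?J. ?B)"
    using D by (auto dest: borel_measurable_has_bochner_integral)
  hence "has_bochner_integral (\<Pi>\<^sub>M j\<in>{1..}. ?B)
       (\<lambda>h. \<Prod>i=1..b. (1 - restrict h ?J i) ^ k) ((\<theta> / (\<theta> + k)) ^ b)"
    using D restr unfolding has_bochner_integral_iff
    by (simp only: integrable_distr_eq integral_distr)
  thus ?thesis by (simp add: prod_power_distrib)
qed

lemma has_bochner_integral_GEM_initial_mass:
  assumes "\<theta> > 0"
  shows "has_bochner_integral (GEM \<theta>) (\<lambda>p. (\<Sum>j=1..b. p j) ^ n)
           (gem_max_cdf \<theta> n b)"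
proof -
  have expand: "(\<Sum>j=1..b. stick_breaking h j) ^ n =
      (\<Sum>k\<le>n. (of_nat (n choose k) * (-1) ^ k) * (\<Prod>i=1..b. 1 - h i) ^ k)" for h
  proof -
    have "(\<Sum>j=1..b. stick_breaking h j) ^ n = (- (\<Prod>i=1..b. 1 - h i) + 1) ^ n"
      unfolding stick_breaking_sum by simp
    thus ?thesis
      unfolding binomial_ring by (simp add: power_minus[of "prod _ _"] mult_ac)
  qed
  have "has_bochner_integral (\<Pi>\<^sub>M j\<in>{1..}. beta_measure 1 \<theta>) (\<lambda>h. (\<Sum>j=1..b. stick_breaking h j) ^ n)
         (\<Sum>k\<le>n. (of_nat (n choose k) * (-1) ^ k) * (\<theta> / (\<theta> + k)) ^ b)"
    unfolding expand
    by (intro has_bochner_integral_sum has_bochner_integral_mult_right has_bochner_integral_remaining_stick assms)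
  moreover have "(\<lambda>p. (\<Sum>j=1..b. p j) ^ n) \<in> borel_measurable (\<Pi>\<^sub>M j\<in>{1::nat..}. (borel :: real measure))"
    by (intro borel_measurable_power borel_measurable_sum) (auto intro!: measurable_component_singleton)
  ultimately show ?thesis unfolding GEM_def gem_max_cdf_def
    using measurable_stick_breaking by (intro has_bochner_integral_distr)
qed

section \<open>Conditioning on the random frequencies\<close>

lemma subalgebra_generated_algebra:
  assumes "\<And>j. j \<ge> 1 \<Longrightarrow> P j \<in> borel_measurable M"
  shows "subalgebra M (generated_algebra M P)"
proof -
  have "(\<lambda>\<omega>. \<lambda>j\<in>{1..}. P j \<omega>) \<in> M \<rightarrow>\<^sub>M (\<Pi>\<^sub>M j\<in>{1..}. borel)"
    using assms by (intro measurable_restrict) auto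
  hence "sets (generated_algebra M P) \<subseteq> sets M"
    unfolding generated_algebra_def by (intro sets_image_in_sets) auto
  thus ?thesis
    by (simp add: subalgebra_def generated_algebra_def)
qed

lemma measurable_discrete_Collect:
  fixes X :: "'a \<Rightarrow> nat"
  assumes "X \<in> M \<rightarrow>\<^sub>M count_space {1..}"
  shows "{\<omega>\<in>space M. X \<omega> \<in> B} \<in> sets M"
proof -
  have "X -` (B \<inter> {1..}) \<inter> space M \<in> sets M"
    by (rule measurable_sets[OF assms]) auto
  also have "X -` (B \<inter> {1..}) \<inter> space M = {\<omega>\<in>space M. X \<omega> \<in> B}"
    using measurable_space[OF assms] by auto
  finally show ?thesis .
qed

lemma conditional_prob_atMost:
  fixes X :: "'a \<Rightarrow> nat"
  assumes "prob_space M" "subalgebra M F"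
    and X: "X \<in> M \<rightarrow>\<^sub>M count_space {1..}"
    and point: "\<And>b. b \<ge> 1 \<Longrightarrow> AE \<omega> in M. conditional_prob M F {\<omega>'\<in>space M. X \<omega>' = b} \<omega> = P b \<omega>"
  shows "AE \<omega> in M. conditional_prob M F {\<omega>'\<in>space M. X \<omega>' \<in> {..b}} \<omega> = (\<Sum>j=1..b. P j \<omega>)"
proof -
  interpret prob_space M by fact
  interpret finite_measure_subalgebra M F by unfold_locales fact
  let ?A = "\<lambda>j. {\<omega>\<in>space M. X \<omega> = j}"
  have A [measurable]: "?A j \<in> sets M" for j
    using measurable_discrete_Collect[OF X, of "{j}"] by simp
  have split: "(indicator {\<omega>\<in>space M. X \<omega> \<in> {..b}} \<omega> :: real) = (\<Sum>j=1..b. indicator (?A j) \<omega>)"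
    if "\<omega> \<in> space M" for \<omega>
    using that measurable_space[OF X that] by (auto simp: indicator_def sum.delta)
  have "AE \<omega> in M. real_cond_exp M F (indicator {\<omega>\<in>space M. X \<omega> \<in> {..b}}) \<omega> =
          real_cond_exp M F (\<lambda>\<omega>. \<Sum>j=1..b. indicator (?A j) \<omega>) \<omega>"
    using measurable_discrete_Collect[OF X, of "{..b}"] A
    by (intro real_cond_exp_cong AE_I2 split) auto
  moreover have "AE \<omega> in M. real_cond_exp M F (\<lambda>\<omega>. \<Sum>j=1..b. indicator (?A j) \<omega>) \<omega> =
      (\<Sum>j=1..b. real_cond_exp M F (indicator (?A j)) \<omega>)"
    by (rule real_cond_exp_sum) (simp add: integrable_real_indicator emeasure_eq_measure A)
  moreover have "AE \<omega> in M. \<forall>j\<in>{1..b}. real_cond_exp M F (indicator (?A j)) \<omega> = P j \<omega>"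
    using point by (intro AE_finite_allI) (auto simp: conditional_prob_def)
  ultimately show ?thesis
    unfolding conditional_prob_def by eventually_elim auto
qed

text \<open>The maximum is at most \<open>b\<close> iff all sample points are. Conditionally on the frequencies these are \<open>n\<close>
  independent events of the same probability, and taking the expectation of the conditional
  probability leaves an integral that depends on the law of the frequencies alone.\<close>
lemma prob_sample_max_atMost:
  assumes "prob_space M" "GEM_sample M \<theta> P n X" "n \<ge> 1"
  shows "measure M {\<omega>\<in>space M. sample_max X n \<omega> \<le> b} = (\<integral>p. (\<Sum>j=1..b. p j) ^ n \<partial>GEM \<theta>)"
proof -
  interpret prob_space M by fact
  let ?F = "generated_algebra M P"
  note sample = assms(2)[unfolded GEM_sample_def]
  have P: "P j \<in> borel_measurable M" if "j \<ge> 1" for j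
    using sample that by blast
  have law: "distr M (\<Pi>\<^sub>M j\<in>{1..}. borel) (\<lambda>\<omega>. \<lambda>j\<in>{1..}. P j \<omega>) = GEM \<theta>"
    and ci: "cond_indep_nat_vars M ?F X {1..n}"
    using sample by blast+
  have X: "X i \<in> M \<rightarrow>\<^sub>M count_space {1..}" if "i \<in> {1..n}" for i
    using sample that by blast
  have point: "AE \<omega> in M. conditional_prob M ?F {\<omega>'\<in>space M. X i \<omega>' = b} \<omega> = P b \<omega>"
    if "i \<in> {1..n}" "b \<ge> 1" for i b
    using sample that by blast
  have sub: "subalgebra M ?F" using P by (rule subalgebra_generated_algebra)
  interpret finite_measure_subalgebra M ?F by unfold_locales (rule sub)
  let ?A = "{\<omega>\<in>space M. \<forall>i\<in>{1..n}. X i \<omega> \<in> {..b}}"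
  have A [measurable]: "?A \<in> sets M"
    using measurable_discrete_Collect[OF X, of _ "{..b}"]
    by (intro sets.sets_Collect_finite_All) auto
  have "AE \<omega> in M. conditional_prob M ?F ?A \<omega> =
      (\<Prod>i\<in>{1..n}. conditional_prob M ?F {\<omega>'\<in>space M. X i \<omega>' \<in> {..b}} \<omega>)"
    using ci[unfolded cond_indep_nat_vars_def, rule_format, of "\<lambda>_. {..b}"] by simp
  moreover have "AE \<omega> in M. \<forall>i\<in>{1..n}.
      conditional_prob M ?F {\<omega>'\<in>space M. X i \<omega>' \<in> {..b}} \<omega> = (\<Sum>j=1..b. P j \<omega>)"
    using X point by (intro AE_finite_allI conditional_prob_atMost prob_space_axioms sub) auto
  ultimately have cond: "AE \<omega> in M. conditional_prob M ?F ?A \<omega> = (\<Sum>j=1..b. P j \<omega>) ^ n"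
    by eventually_elim simp
  have "{\<omega>\<in>space M. sample_max X n \<omega> \<le> b} = ?A"
    using assms(3) by (auto simp: sample_max_def)
  hence "measure M {\<omega>\<in>space M. sample_max X n \<omega> \<le> b} = (\<integral>\<omega>. indicator ?A \<omega> \<partial>M)"
    using A by simp
  also have "\<dots> = (\<integral>\<omega>. conditional_prob M ?F ?A \<omega> \<partial>M)"
    unfolding conditional_prob_def
    by (rule real_cond_exp_int(2)[symmetric]) (rule integrable_real_indicator[OF A], simp add: emeasure_eq_measure)
  also have "\<dots> = (\<integral>\<omega>. (\<Sum>j=1..b. P j \<omega>) ^ n \<partial>M)"
  proof (rule integral_cong_AE[OF _ _ cond])
    show "conditional_prob M ?F ?A \<in> borel_measurable M"
      unfolding conditional_prob_def by simp
    show "(\<lambda>\<omega>. (\<Sum>j=1..b. P j \<omega>) ^ n) \<in> borel_measurable M"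
      using P by (intro borel_measurable_power borel_measurable_sum) auto
  qed
  also have "\<dots> = (\<integral>\<omega>. (\<Sum>j=1..b. (\<lambda>j\<in>{1..}. P j \<omega>) j) ^ n \<partial>M)"
    by simp
  also have "\<dots> = (\<integral>p. (\<Sum>j=1..b. p j) ^ n
      \<partial>distr M (\<Pi>\<^sub>M j\<in>{1..}. borel) (\<lambda>\<omega>. \<lambda>j\<in>{1..}. P j \<omega>))"
    using P by (intro integral_distr[symmetric] measurable_restrict borel_measurable_power borel_measurable_sum)
      (auto intro!: measurable_component_singleton)
  finally show ?thesis by (simp only: law)
qed

lemma measurable_sample_max:
  assumes X: "\<And>i. i \<in> {1..n} \<Longrightarrow> X i \<in> M \<rightarrow>\<^sub>M count_space {1..}" and "n \<ge> 1"
  shows "sample_max X n \<in> M \<rightarrow>\<^sub>M count_space UNIV"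
proof (subst measurable_count_space_eq2_countable, safe)
  fix k :: nat
  have "sample_max X n -` {k} \<inter> space M =
      {\<omega>\<in>space M. (\<forall>i\<in>{1..n}. X i \<omega> \<in> {..k}) \<and> (\<exists>i\<in>{1..n}. X i \<omega> \<in> {k})}"
  proof -
    have "sample_max X n \<omega> = k \<longleftrightarrow> (\<forall>i\<in>{1..n}. X i \<omega> \<le> k) \<and> (\<exists>i\<in>{1..n}. X i \<omega> = k)" for \<omega>
      unfolding sample_max_def by (subst Max_eq_iff) (use assms(2) in auto)
    thus ?thesis by auto
  qed
  also have "\<dots> \<in> sets M"
    by (intro sets.sets_Collect_conj sets.sets_Collect_finite_All sets.sets_Collect_finite_Ex
        measurable_discrete_Collect X) auto
  finally show "sample_max X n -` {k} \<inter> space M \<in> sets M" .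
qed auto

section \<open>Sums of independent geometric variables\<close>

text \<open>Lack of memory: \<open>G\<close> vanishes with probability \<open>p\<close>, which leaves \<open>S\<close>; conditionally on \<open>G > 0\<close>, \<open>G - 1\<close> is again
  geometric and independent of \<open>S\<close>, and the bound drops by one. In the proof this is the split of
  the convolution sum into its term \<open>g = 0\<close> and the remaining terms.\<close>
lemma prob_sum_geometric_step:
  fixes S G :: "'b \<Rightarrow> nat"
  assumes "prob_space M"
    and indep: "prob_space.indep_var M (count_space UNIV) G (count_space UNIV) S"
    and law: "distr M (count_space UNIV) G = measure_pmf (geometric_pmf p)"
    and p: "0 < p" "p \<le> 1"
  shows "measure M {\<omega>\<in>space M. G \<omega> + S \<omega> < Suc b} =
         p * measure M {\<omega>\<in>space M. S \<omega> < Suc b} + (1 - p) * measure M {\<omega>\<in>space M. G \<omega> + S \<omega> < b}"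
proof -
  interpret prob_space M by fact
  have [measurable]: "G \<in> M \<rightarrow>\<^sub>M count_space UNIV" "S \<in> M \<rightarrow>\<^sub>M count_space UNIV"
    using indep by (auto dest: indep_var_rv1 indep_var_rv2)
  have G: "prob (G -` {g} \<inter> space M) = p * (1 - p) ^ g" for g
  proof -
    have "prob (G -` {g} \<inter> space M) = measure (distr M (count_space UNIV) G) {g}"
      by (subst measure_distr) auto
    thus ?thesis using p by (simp add: law measure_pmf_single mult.commute)
  qed
  have conv: "prob {\<omega>\<in>space M. G \<omega> + S \<omega> < b} =
      (\<Sum>g<b. p * (1 - p) ^ g * prob {\<omega>\<in>space M. S \<omega> < b - g})" for b
  proof -
    have "{\<omega>\<in>space M. G \<omega> + S \<omega> < b} = (\<Union>g\<in>{..<b}. (\<lambda>\<omega>. (G \<omega>, S \<omega>)) -` ({g} \<times> {..<b - g}) \<inter> space M)"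
      by auto
    also have "prob \<dots> = (\<Sum>g<b. prob ((\<lambda>\<omega>. (G \<omega>, S \<omega>)) -` ({g} \<times> {..<b - g}) \<inter> space M))"
    proof (rule finite_measure_finite_Union)
      have "(\<lambda>\<omega>. (G \<omega>, S \<omega>)) -` ({g} \<times> {..<b - g}) \<inter> space M = {\<omega>\<in>space M. G \<omega> = g \<and> S \<omega> < b - g}" for g
        by auto
      thus "(\<lambda>g. (\<lambda>\<omega>. (G \<omega>, S \<omega>)) -` ({g} \<times> {..<b - g}) \<inter> space M) ` {..<b} \<subseteq> events"
        by auto
    qed (auto simp: disjoint_family_on_def)
    also have "\<dots> = (\<Sum>g<b. p * (1 - p) ^ g * prob {\<omega>\<in>space M. S \<omega> < b - g})"
    proof (rule sum.cong[OF refl])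
      fix g
      have "S -` {..<b - g} \<inter> space M = {\<omega>\<in>space M. S \<omega> < b - g}" by auto
      thus "prob ((\<lambda>\<omega>. (G \<omega>, S \<omega>)) -` ({g} \<times> {..<b - g}) \<inter> space M) =
          p * (1 - p) ^ g * prob {\<omega>\<in>space M. S \<omega> < b - g}"
        by (subst indep_varD[OF indep]) (auto simp: G)
    qed
    finally show ?thesis .
  qed
  show ?thesis
    unfolding conv by (subst sum.lessThan_Suc_shift) (simp add: sum_distrib_left mult_ac)
qed

lemma (in prob_space) indep_var_sum_nat:
  fixes X :: "'i \<Rightarrow> 'a \<Rightarrow> nat"
  assumes I: "finite I" "i \<notin> I" and indep: "indep_vars (\<lambda>_. count_space UNIV) X (insert i I)"
  shows "indep_var (count_space UNIV) (X i) (count_space UNIV) (\<lambda>\<omega>. \<Sum>i\<in>I. X i \<omega>)"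
proof -
  have "indep_var
    (count_space UNIV) ((\<lambda>f. f i) \<circ> (\<lambda>\<omega>. restrict (\<lambda>i. X i \<omega>) {i}))
    (count_space UNIV) ((\<lambda>f. \<Sum>i\<in>I. f i) \<circ> (\<lambda>\<omega>. restrict (\<lambda>i. X i \<omega>) I))"
    using I by (intro indep_var_compose[OF indep_var_restrict[OF indep]]) auto
  also have "((\<lambda>f. \<Sum>i\<in>I. f i) \<circ> (\<lambda>\<omega>. restrict (\<lambda>i. X i \<omega>) I)) = (\<lambda>\<omega>. \<Sum>i\<in>I. X i \<omega>)"
    by (auto cong: sum.cong)
  also have "((\<lambda>f. f i) \<circ> (\<lambda>\<omega>. restrict (\<lambda>i. X i \<omega>) {i})) = X i"
    by auto
  finally show ?thesis .
qed

text \<open>Both sides satisfy the recurrence of \<open>gem_max_cdf_Suc\<close>. The case \<open>n = b = 0\<close> is excluded: there the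
  empty sum is not below \<open>0\<close>, whereas \<open>gem_max_cdf\<close> equals \<open>1\<close>.\<close>
lemma prob_sum_geometric_less:
  fixes G :: "nat \<Rightarrow> 'b \<Rightarrow> nat"
  assumes "prob_space M" "\<theta> > 0"
    and "prob_space.indep_vars M (\<lambda>_. count_space UNIV) G {1..n}"
    and "\<And>i. i \<in> {1..n} \<Longrightarrow>
           distr M (count_space UNIV) (G i) = measure_pmf (geometric_pmf (real i / (real i + \<theta>)))"
    and "n \<ge> 1 \<or> b \<ge> 1"
  shows "measure M {\<omega>\<in>space M. (\<Sum>i=1..n. G i \<omega>) < b} = gem_max_cdf \<theta> n b"
  using assms(3-5)
proof (induction n arbitrary: b)
  case 0
  interpret prob_space M by fact
  show ?case using 0 assms(2) by (simp add: gem_max_cdf_0_left prob_space)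
next
  case (Suc n)
  interpret prob_space M by fact
  let ?S = "\<lambda>n \<omega>. \<Sum>i=1..n. G i \<omega>"
  define p where "p = real (Suc n) / (real (Suc n) + \<theta>)"
  have split: "{1..Suc n} = insert (Suc n) {1..n}" by auto
  have p: "0 < p" "p \<le> 1" "1 - p = \<theta> / (real (Suc n) + \<theta>)"
    using assms(2) by (auto simp: p_def field_simps)
  have indep: "indep_var (count_space UNIV) (G (Suc n)) (count_space UNIV) (?S n)"
    using Suc.prems(1) unfolding split by (intro indep_var_sum_nat) auto
  have law: "distr M (count_space UNIV) (G (Suc n)) = measure_pmf (geometric_pmf p)"
    unfolding p_def by (rule Suc.prems(2)) simp
  have IH: "prob {\<omega>\<in>space M. ?S n \<omega> < Suc b} = gem_max_cdf \<theta> n (Suc b)" for b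
    using Suc.prems(1,2) by (intro Suc.IH indep_vars_subset[OF Suc.prems(1)]) auto
  show ?case
  proof (induction b)
    case 0
    show ?case by (simp add: gem_max_cdf_0_right)
  next
    case (Suc b)
    have "prob {\<omega>\<in>space M. ?S (Suc n) \<omega> < Suc b} =
        p * gem_max_cdf \<theta> n (Suc b) + (1 - p) * gem_max_cdf \<theta> (Suc n) b"
      using prob_sum_geometric_step[OF prob_space_axioms indep _ p(1,2), of b] law IH Suc.IH
      by (simp add: add.commute)
    also have "\<dots> = (real (Suc n) * gem_max_cdf \<theta> n (Suc b) + \<theta> * gem_max_cdf \<theta> (Suc n) b) / (\<theta> + real (Suc n))"
      by (subst p(3)) (simp only: p_def add_divide_distrib times_divide_eq_left add.commute)
    also have "\<dots> = gem_max_cdf \<theta> (Suc n) (Suc b)"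
      unfolding gem_max_cdf_Suc[OF assms(2), symmetric] using assms(2) by simp
    finally show ?case .
  qed
qed

section \<open>The law of the maximum\<close>

lemma nat_measure_eqI:
  fixes N N' :: "nat measure"
  assumes "finite_measure N" "finite_measure N'"
    and sets: "sets N = UNIV" "sets N' = UNIV"
    and cdf: "\<And>b. measure N {..b} = measure N' {..b}"
  shows "N = N'"
proof (rule measure_eqI_countable[where A = UNIV])
  interpret N: finite_measure N by fact
  interpret N': finite_measure N' by fact
  fix k :: nat
  have "measure N {k} = measure N' {k}"
  proof (cases k)
    case 0
    thus ?thesis using cdf[of 0] by simp
  next
    case (Suc j)
    have "{k} = {..k} - {..j}" using Suc by auto
    thus ?thesis
      using N.finite_measure_Diff[of "{..k}" "{..j}"] N'.finite_measure_Diff[of "{..k}" "{..j}"]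
        cdf[of k] cdf[of j] Suc sets by simp
  qed
  thus "emeasure N {k} = emeasure N' {k}"
    by (simp add: N.emeasure_eq_measure N'.emeasure_eq_measure)
qed (use sets in auto)

theorem corollary1p3:
  fixes M :: "'a measure" and M' :: "'b measure"
    and \<theta> :: real and n :: nat
    and P :: "nat \<Rightarrow> 'a \<Rightarrow> real" and X :: "nat \<Rightarrow> 'a \<Rightarrow> nat"
    and G :: "nat \<Rightarrow> 'b \<Rightarrow> nat"
  assumes "\<theta> > 0" and "n \<ge> 1"
    and "prob_space M" and "GEM_sample M \<theta> P n X"
    and "prob_space M'"
    and "prob_space.indep_vars M' (\<lambda>_. count_space UNIV) G {1..n}"
    and "\<And>i. i \<in> {1..n} \<Longrightarrow>
           distr M' (count_space UNIV) (G i) = measure_pmf (geometric_pmf (real i / (real i + \<theta>)))"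
  shows "(\<forall>\<omega>\<in>space M.
            sample_max X n \<omega> = Max {b. b \<ge> 1 \<and> sample_count X n b \<omega> > 0} \<and>
            sample_max X n \<omega> = 1 + (\<Sum>i=1..n. sample_gap X n i \<omega>)) \<and>
         distr M (count_space UNIV) (sample_max X n) =
         distr M' (count_space UNIV) (\<lambda>\<omega>. 1 + (\<Sum>i=1..n. G i \<omega>))"
proof (intro conjI ballI)
  note sample = assms(4)[unfolded GEM_sample_def]
  have X: "X i \<in> M \<rightarrow>\<^sub>M count_space {1..}" if "i \<in> {1..n}" for i
    using sample that by blast
  {
    fix \<omega> assume "\<omega> \<in> space M"
    hence ge1: "X i \<omega> \<ge> 1" if "i \<in> {1..n}" for i
      using measurable_space[OF X[OF that]] by auto
    show "sample_max X n \<omega> = Max {b. b \<ge> 1 \<and> sample_count X n b \<omega> > 0}"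
      using ge1 by (rule sample_max_eq_Max_counted)
    show "sample_max X n \<omega> = 1 + (\<Sum>i=1..n. sample_gap X n i \<omega>)"
      using assms(2) ge1 by (rule sample_max_eq_sum_gaps)
  }
  interpret M: prob_space M by fact
  interpret M': prob_space M' by fact
  have max [measurable]: "sample_max X n \<in> M \<rightarrow>\<^sub>M count_space UNIV"
    using X assms(2) by (rule measurable_sample_max)
  have [measurable]: "G i \<in> M' \<rightarrow>\<^sub>M count_space UNIV" if "i \<in> {1..n}" for i
    using assms(6) that by (auto simp: M'.indep_vars_def)
  have sum [measurable]: "(\<lambda>\<omega>. 1 + (\<Sum>i=1..n. G i \<omega>)) \<in> M' \<rightarrow>\<^sub>M count_space UNIV"
    by measurable
  show "distr M (count_space UNIV) (sample_max X n) =
        distr M' (count_space UNIV) (\<lambda>\<omega>. 1 + (\<Sum>i=1..n. G i \<omega>))"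
  proof (rule nat_measure_eqI)
    show "finite_measure (distr M (count_space UNIV) (sample_max X n))"
      by (intro M.finite_measure_distr max)
    show "finite_measure (distr M' (count_space UNIV) (\<lambda>\<omega>. 1 + (\<Sum>i=1..n. G i \<omega>)))"
      by (intro M'.finite_measure_distr sum)
    fix b
    have "measure (distr M (count_space UNIV) (sample_max X n)) {..b} =
        M.prob {\<omega>\<in>space M. sample_max X n \<omega> \<le> b}"
      by (subst measure_distr[OF max]) (auto intro!: arg_cong[where f = M.prob])
    also have "\<dots> = gem_max_cdf \<theta> n b"
      using prob_sample_max_atMost[OF assms(3,4,2)] has_bochner_integral_GEM_initial_mass[OF assms(1)]
      by (simp add: has_bochner_integral_iff)
    also have "\<dots> = M'.prob {\<omega>\<in>space M'. (\<Sum>i=1..n. G i \<omega>) < b}"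
      using assms by (intro prob_sum_geometric_less[symmetric]) auto
    also have "\<dots> = measure (distr M' (count_space UNIV) (\<lambda>\<omega>. 1 + (\<Sum>i=1..n. G i \<omega>))) {..b}"
      by (subst measure_distr[OF sum]) (auto intro!: arg_cong[where f = M'.prob])
    finally show "measure (distr M (count_space UNIV) (sample_max X n)) {..b} =
        measure (distr M' (count_space UNIV) (\<lambda>\<omega>. 1 + (\<Sum>i=1..n. G i \<omega>))) {..b}" .
  qed auto
qed

end
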